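(* For all odd primes $p$ and $q$, the group $Q_8\times\mathbb{Z}_{pq}$ is not a Schur group.
   Context: Notation: $\mathbb{Z}_n$ is the cyclic group of order $n$; $Q_8$ is the quaternion group of order $8$. The primes $p$ and $q$ are allowed to be equal. Let $G$ be a finite group with identity $e$. For $X\subseteq G$ put $\underline{X}=\sum_{x\in X}x\in\mathbb{Z}G$ and $X^{-1}=\{x^{-1}:x\in X\}$. A subring $\mathcal{A}\subseteq\mathbb{Z}G$ is an S-ring over $G$ if there is a partition $\mathcal{S}$ of $G$ such that (1) $\{e\}\in\mathcal{S}$; (2) $X\in\mathcal{S}$ implies $X^{-1}\in\mathcal{S}$; (3) $\mathcal{A}=\mathrm{Span}_{\mathbb{Z}}\{\underline{X}:X\in\mathcal{S}\}$. Let $G_r\leq\mathrm{Sym}(G)$ be the group of right translations of $G$. For $K\leq \mathrm{Sym}(G)$ with $K\geq G_r$, the $\mathbb{Z}$-module $V(K,G)=\mathrm{Span}_{\mathbb{Z}}\{\underline{X}: X \text{ is an orbit of } K_e \text{ on } G\}$, where $K_e$ is the stabilizer of $e$ in $K$, is an S-ring over $G$. An S-ring $\mathcal{A}$ over $G$ is schurian if $\mathcal{A}=V(K,G)$ for some $K$ with $G_r\leq K\leq\mathrm{Sym}(G)$. The group $G$ is a Schur group if every S-ring over $G$ is schurian. *)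

theory Defs
  imports
    "HOL-Algebra.Group_Action"
    "HOL-Algebra.Subrings"
    "HOL-Algebra.Elementary_Groups"
    "HOL-Library.Disjoint_Sets"
    "HOL-Computational_Algebra.Primes"
begin

section \<open>The integral group ring of a finite group\<close>

text \<open>
  Elements of the group ring are integer-valued functions vanishing outside the carrier; the
  product is convolution.  The sum is meaningful only for a finite carrier.
\<close>

definition group_ring :: "('a, 'b) monoid_scheme \<Rightarrow> ('a \<Rightarrow> int) ring"
  where "group_ring G =
    \<lparr>carrier = {f. \<forall>x. x \<notin> carrier G \<longrightarrow> f x = 0},
     monoid.mult = (\<lambda>f g x. if x \<in> carrier G
                     then \<Sum>y\<in>carrier G. f y * g (inv\<^bsub>G\<^esub> y \<otimes>\<^bsub>G\<^esub> x) else 0),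
     one = (\<lambda>x. if x = \<one>\<^bsub>G\<^esub> then 1 else 0),
     zero = (\<lambda>x. 0),
     add = (\<lambda>f g x. f x + g x)\<rparr>"

lemma ring_group_ring:
  fixes G (structure)
  assumes "group G" "finite (carrier G)"
  shows "ring (group_ring G)"
proof -
  interpret group G by fact
  have delta: "(\<Sum>y\<in>carrier G. (if y = \<one> then 1 else 0) * h y) = h \<one>" for h :: "_ \<Rightarrow> int"
    using assms(2) by (simp add: if_distrib[of "\<lambda>c. c * _"] sum.delta cong: if_cong)
  have c1: "z \<otimes> (inv z \<otimes> x) = x" and c2: "inv z \<otimes> (z \<otimes> x) = x" if "z \<in> carrier G" "x \<in> carrier G" for z x
    using that by (simp_all add: m_assoc[symmetric])
  have c3: "inv y \<otimes> x = \<one> \<longleftrightarrow> y = x" if "y \<in> carrier G" "x \<in> carrier G" for x y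
    using that c1 by (metis l_inv r_one)
  show ?thesis
  proof (rule ringI)
    show "abelian_group (group_ring G)"
      apply (rule abelian_groupI)
      subgoal by (simp add: group_ring_def)
      subgoal by (simp add: group_ring_def)
      subgoal by (simp add: group_ring_def add.assoc)
      subgoal by (simp add: group_ring_def add.commute)
      subgoal by (simp add: group_ring_def)
      subgoal for f by (rule bexI[of _ "\<lambda>x. - f x"]) (simp_all add: group_ring_def)
      done
    show "Group.monoid (group_ring G)"
    proof (rule monoidI)
      fix f g h assume f: "f \<in> carrier (group_ring G)" "g \<in> carrier (group_ring G)" "h \<in> carrier (group_ring G)"
      show "f \<otimes>\<^bsub>group_ring G\<^esub> g \<otimes>\<^bsub>group_ring G\<^esub> h = f \<otimes>\<^bsub>group_ring G\<^esub> (g \<otimes>\<^bsub>group_ring G\<^esub> h)"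
      proof
        fix x
        show "(f \<otimes>\<^bsub>group_ring G\<^esub> g \<otimes>\<^bsub>group_ring G\<^esub> h) x = (f \<otimes>\<^bsub>group_ring G\<^esub> (g \<otimes>\<^bsub>group_ring G\<^esub> h)) x"
        proof (cases "x \<in> carrier G")
          case True
          have *: "(\<Sum>y\<in>carrier G. g (inv z \<otimes> y) * h (inv y \<otimes> x)) = (\<Sum>y\<in>carrier G. g y * h (inv y \<otimes> (inv z \<otimes> x)))" if z: "z \<in> carrier G" for z
            by (rule sum.reindex_bij_witness[of _ "\<lambda>y. z \<otimes> y" "\<lambda>y. inv z \<otimes> y"])
              (use z True c1 c2 in \<open>auto simp: m_assoc inv_mult_group\<close>)
          have "(\<Sum>y\<in>carrier G. (\<Sum>z\<in>carrier G. f z * g (inv z \<otimes> y)) * h (inv y \<otimes> x))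
            = (\<Sum>z\<in>carrier G. f z * (\<Sum>y\<in>carrier G. g (inv z \<otimes> y) * h (inv y \<otimes> x)))"
            unfolding sum_distrib_left sum_distrib_right mult.assoc by (rule sum.swap)
          also have "\<dots> = (\<Sum>z\<in>carrier G. f z * (\<Sum>y\<in>carrier G. g y * h (inv y \<otimes> (inv z \<otimes> x))))"
            by (intro sum.cong refl) (simp add: *)
          finally show ?thesis using True by (simp add: group_ring_def)
        qed (simp add: group_ring_def)
      qed
    next
      fix f assume f: "f \<in> carrier (group_ring G)"
      show "\<one>\<^bsub>group_ring G\<^esub> \<otimes>\<^bsub>group_ring G\<^esub> f = f"
        using f by (auto simp: group_ring_def delta fun_eq_iff)
      show "f \<otimes>\<^bsub>group_ring G\<^esub> \<one>\<^bsub>group_ring G\<^esub> = f"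
      proof
        fix x
        have "(\<Sum>y\<in>carrier G. f y * (if inv y \<otimes> x = \<one> then 1 else 0)) = (\<Sum>y\<in>carrier G. if y = x then f y else 0)" if "x \<in> carrier G"
          using that by (intro sum.cong refl) (simp add: c3)
        then show "(f \<otimes>\<^bsub>group_ring G\<^esub> \<one>\<^bsub>group_ring G\<^esub>) x = f x"
          using f assms(2) by (auto simp: group_ring_def sum.delta)
      qed
    qed (auto simp: group_ring_def)
  qed (auto simp: group_ring_def fun_eq_iff algebra_simps sum.distrib)
qed

definition simple_quantity :: "'a set \<Rightarrow> 'a \<Rightarrow> int"
  where "simple_quantity X = (\<lambda>x. if x \<in> X then 1 else 0)"

text \<open>The integral span of the simple quantities of the members of a finite family of sets.\<close>

definition simple_span :: "'a set set \<Rightarrow> ('a \<Rightarrow> int) set"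
  where "simple_span \<S> = {\<lambda>x. \<Sum>X\<in>\<S>. c X * simple_quantity X x | c :: 'a set \<Rightarrow> int. True}"


section \<open>S-rings and Schur groups\<close>

definition S_ring :: "('a, 'b) monoid_scheme \<Rightarrow> ('a \<Rightarrow> int) set \<Rightarrow> bool"
  where "S_ring G A \<longleftrightarrow>
    subring A (group_ring G) \<and>
    (\<exists>\<S>. partition_on (carrier G) \<S> \<and>
         {\<one>\<^bsub>G\<^esub>} \<in> \<S> \<and>
         (\<forall>X\<in>\<S>. m_inv G ` X \<in> \<S>) \<and>
         A = simple_span \<S>)"

text \<open>Elements of the symmetric group \<open>BijGroup\<close> are extensional, hence the restricted abstraction.\<close>

definition right_translations :: "('a, 'b) monoid_scheme \<Rightarrow> ('a \<Rightarrow> 'a) set"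
  where "right_translations G = {\<lambda>x\<in>carrier G. x \<otimes>\<^bsub>G\<^esub> g | g. g \<in> carrier G}"

definition point_stabilizer ::
    "('a, 'b) monoid_scheme \<Rightarrow> ('a \<Rightarrow> 'a) set \<Rightarrow> ('a \<Rightarrow> 'a) set"
  where "point_stabilizer G K =
    stabilizer (BijGroup (carrier G)\<lparr>carrier := K\<rparr>) (\<lambda>f. f) \<one>\<^bsub>G\<^esub>"

definition transitivity_module ::
    "('a \<Rightarrow> 'a) set \<Rightarrow> ('a, 'b) monoid_scheme \<Rightarrow> ('a \<Rightarrow> int) set"
  where "transitivity_module K G =
    simple_span (orbits (BijGroup (carrier G)\<lparr>carrier := point_stabilizer G K\<rparr>)
                        (carrier G) (\<lambda>f. f))"

definition schurian :: "('a, 'b) monoid_scheme \<Rightarrow> ('a \<Rightarrow> int) set \<Rightarrow> bool"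
  where "schurian G A \<longleftrightarrow>
    (\<exists>K. subgroup K (BijGroup (carrier G)) \<and>
         right_translations G \<subseteq> K \<and>
         A = transitivity_module K G)"

definition Schur_group :: "('a, 'b) monoid_scheme \<Rightarrow> bool"
  where "Schur_group G \<longleftrightarrow> (\<forall>A. S_ring G A \<longrightarrow> schurian G A)"


section \<open>The quaternion group of order 8\<close>

text \<open>
  The tuple \<open>(a, b, c, d)\<close> stands for the quaternion \<open>a + b i + c j + d k\<close>; the group consists of
  \<open>\<plusminus>1, \<plusminus>i, \<plusminus>j, \<plusminus>k\<close> under the Hamilton product.
\<close>

definition Q8 :: "(int \<times> int \<times> int \<times> int) monoid"
  where "Q8 =
    \<lparr>carrier = {(1,0,0,0), (-1,0,0,0), (0,1,0,0), (0,-1,0,0),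
                (0,0,1,0), (0,0,-1,0), (0,0,0,1), (0,0,0,-1)},
     monoid.mult = (\<lambda>(a, b, c, d) (a', b', c', d').
       (a * a' - b * b' - c * c' - d * d',
        a * b' + b * a' + c * d' - d * c',
        a * c' - b * d' + c * a' + d * b',
        a * d' + b * c' - c * b' + d * a')),
     one = (1, 0, 0, 0)\<rparr>"

lemma group_Q8: "group Q8"
proof (rule groupI)
  fix x y assume "x \<in> carrier Q8" and "y \<in> carrier Q8"
  then show "x \<otimes>\<^bsub>Q8\<^esub> y \<in> carrier Q8"
    unfolding Q8_def by (simp only: partial_object.simps insert_iff empty_iff) (elim disjE; simp)
next
  fix x assume "x \<in> carrier Q8"
  then show "\<exists>y\<in>carrier Q8. y \<otimes>\<^bsub>Q8\<^esub> x = \<one>\<^bsub>Q8\<^esub>"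
    unfolding Q8_def by (simp only: partial_object.simps insert_iff empty_iff) (elim disjE; simp)
next
  fix x y z
  show "x \<otimes>\<^bsub>Q8\<^esub> y \<otimes>\<^bsub>Q8\<^esub> z = x \<otimes>\<^bsub>Q8\<^esub> (y \<otimes>\<^bsub>Q8\<^esub> z)"
    by (cases x; cases y; cases z) (simp add: Q8_def algebra_simps)
next
  fix x
  show "\<one>\<^bsub>Q8\<^esub> \<otimes>\<^bsub>Q8\<^esub> x = x"
    by (cases x) (simp add: Q8_def)
qed (simp add: Q8_def)

lemma order_Q8: "order Q8 = 8"
  by (simp add: order_def Q8_def)

end

theory Submission
  imports Defs
begin

text \<open>
  Write \<open>P\<close> for the subgroup of order \<open>p\<close> of the cyclic factor.  On \<open>U = Q8 \<times> P\<close> take the orbits of the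
  automorphism group generated by the inner automorphisms of \<open>Q8\<close> and by \<open>(\<sigma>, -1)\<close>, where \<open>\<sigma>\<close>
  inverts \<open>i\<close> and swaps \<open>j\<close> and \<open>k\<close>.  Outside \<open>U\<close> take unions of cosets of \<open>P\<close> that are invariant under
  the smaller group generated by conjugation by \<open>i\<close> and by \<open>(\<sigma>, -1)\<close>.  Both groups have the same orbits
  on \<open>Q8 = U / P\<close>, which makes the resulting span closed under multiplication.

  If this S-ring were schurian, some permutation \<open>k\<close> fixing the identity would map \<open>(i, x)\<close> to \<open>(-i, x)\<close>
  for \<open>x \<noteq> 0\<close> in \<open>P\<close>.  Comparing with \<open>(1, x)\<close> shows that \<open>k\<close> fixes \<open>(1, x)\<close>, so it maps \<open>(j, 0)\<close> to
  \<open>(\<plusminus>j, 0)\<close>; hence it acts trivially on the cosets of \<open>P\<close> of the form \<open>(1, \<plusminus>1 + P)\<close>, which in turn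
  forces it to fix \<open>(i, 0)\<close>.  But then the quotient of \<open>(i, x)\<close> and \<open>(i, 0)\<close> is sent from \<open>(1, x)\<close> to
  \<open>(-1, x)\<close>, although these lie in different basic sets.
\<close>

section \<open>S-rings of invariant functions\<close>

definition invariant_functions :: "'a set \<Rightarrow> ('a \<times> 'a) set \<Rightarrow> ('a \<Rightarrow> int) set"
  where "invariant_functions X R = {f. (\<forall>x. x \<notin> X \<longrightarrow> f x = 0) \<and> (\<forall>(x, y)\<in>R. f x = f y)}"

definition inseparable :: "'a set \<Rightarrow> ('a \<times> 'a) set \<Rightarrow> ('a \<times> 'a) set"
  where "inseparable X R = {(x, y) \<in> X \<times> X. \<forall>f\<in>invariant_functions X R. f x = f y}"

lemma invariant_functionsI:
  "(\<And>x. x \<notin> X \<Longrightarrow> f x = 0) \<Longrightarrow> (\<And>x y. (x, y) \<in> R \<Longrightarrow> f x = f y) \<Longrightarrow> f \<in> invariant_functions X R"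
  by (auto simp: invariant_functions_def)

lemma invariant_functions_outside: "f \<in> invariant_functions X R \<Longrightarrow> x \<notin> X \<Longrightarrow> f x = 0"
  by (simp add: invariant_functions_def)

lemma invariant_functionsD: "f \<in> invariant_functions X R \<Longrightarrow> (x, y) \<in> R \<Longrightarrow> f x = f y"
  by (auto simp: invariant_functions_def)

lemma equiv_inseparable: "equiv X (inseparable X R)"
  by (rule equivI) (auto simp: inseparable_def refl_on_def sym_def trans_def)

lemma simple_quantity_invariant:
  assumes "W \<subseteq> X" and "\<And>x y. (x, y) \<in> R \<Longrightarrow> x \<in> W \<longleftrightarrow> y \<in> W"
  shows "simple_quantity W \<in> invariant_functions X R"
  using assms by (intro invariant_functionsI) (auto simp: simple_quantity_def)

lemma sum_simple_quantity:
  assumes "partition_on X \<S>" "finite \<S>" "W \<in> \<S>" "x \<in> W"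
  shows "(\<Sum>Y\<in>\<S>. c Y * simple_quantity Y x) = c W"
proof -
  have "c Y * simple_quantity Y x = (if Y = W then c W else 0)" if "Y \<in> \<S>" for Y
    using that assms partition_onD2[OF assms(1)]
    by (auto simp: simple_quantity_def disjoint_def)
  then show ?thesis
    using assms by (simp add: sum.delta cong: sum.cong)
qed

lemma sum_simple_quantity_outside:
  assumes "partition_on X \<S>" "x \<notin> X"
  shows "(\<Sum>Y\<in>\<S>. c Y * simple_quantity Y x) = 0"
  using assms by (intro sum.neutral) (auto simp: simple_quantity_def partition_on_def)

lemma simple_span_eq_constant_on:
  assumes P: "partition_on X \<S>" and fin: "finite X"
  shows "simple_span \<S> = {f. (\<forall>x. x \<notin> X \<longrightarrow> f x = 0) \<and> (\<forall>W\<in>\<S>. \<forall>x\<in>W. \<forall>y\<in>W. f x = f y)}"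
    (is "_ = ?C")
proof (intro equalityI subsetI)
  fix f assume "f \<in> simple_span \<S>"
  then obtain c where "f = (\<lambda>x. \<Sum>Y\<in>\<S>. c Y * simple_quantity Y x)"
    by (auto simp: simple_span_def)
  then show "f \<in> ?C"
    using sum_simple_quantity[OF P finite_elements[OF fin P]] sum_simple_quantity_outside[OF P]
    by simp
next
  fix f assume f: "f \<in> ?C"
  have "f x = (\<Sum>Y\<in>\<S>. f (SOME z. z \<in> Y) * simple_quantity Y x)" for x
  proof (cases "x \<in> X")
    case True
    then obtain W where W: "W \<in> \<S>" "x \<in> W"
      using partition_onD1[OF P] by auto
    then have "f (SOME z. z \<in> W) = f x"
      using f someI[of "\<lambda>z. z \<in> W" x] by blast
    then show ?thesis
      using sum_simple_quantity[OF P finite_elements[OF fin P] W] by simp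
  next
    case False
    then show ?thesis
      using f sum_simple_quantity_outside[OF P] by simp
  qed
  then have "f = (\<lambda>x. \<Sum>Y\<in>\<S>. f (SOME z. z \<in> Y) * simple_quantity Y x)"
    by blast
  then show "f \<in> simple_span \<S>"
    by (auto simp: simple_span_def)
qed

lemma invariant_functions_eq_simple_span:
  assumes "finite X" "R \<subseteq> X \<times> X"
  shows "invariant_functions X R = simple_span (X // inseparable X R)"
proof -
  have R: "R \<subseteq> inseparable X R"
    using assms(2) by (auto simp: inseparable_def dest: invariant_functionsD)
  show ?thesis
    unfolding simple_span_eq_constant_on[OF partition_on_quotient[OF equiv_inseparable] assms(1)]
  proof (intro equalityI subsetI CollectI conjI allI impI ballI)
    fix f W x y
    assume "f \<in> invariant_functions X R" "W \<in> X // inseparable X R" "x \<in> W" "y \<in> W"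
    then have "(x, y) \<in> inseparable X R"
      using quotient_eq_iff[OF equiv_inseparable] by metis
    with \<open>f \<in> _\<close> show "f x = f y"
      by (auto simp: inseparable_def)
  next
    fix f :: "_ \<Rightarrow> int"
    assume f: "f \<in> {f. (\<forall>x. x \<notin> X \<longrightarrow> f x = 0) \<and>
      (\<forall>W\<in>X // inseparable X R. \<forall>x\<in>W. \<forall>y\<in>W. f x = f y)}"
    show "f \<in> invariant_functions X R"
    proof (rule invariant_functionsI)
      fix x y assume xy: "(x, y) \<in> R"
      then have "x \<in> X" "y \<in> inseparable X R `` {x}" "x \<in> inseparable X R `` {x}"
        using R assms(2) by (auto simp: inseparable_def)
      then show "f x = f y"
        using f quotientI[of x X "inseparable X R"] by blast
    qed (use f in blast)
  qed (auto dest: invariant_functions_outside)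
qed

lemma S_ring_invariant_functions:
  fixes G (structure)
  assumes "group G" "finite (carrier G)" and R: "R \<subseteq> carrier G \<times> carrier G"
    and one: "\<And>x y. (x, y) \<in> R \<Longrightarrow> x = \<one>\<^bsub>G\<^esub> \<longleftrightarrow> y = \<one>\<^bsub>G\<^esub>"
    and inv: "\<And>f x y. f \<in> invariant_functions (carrier G) R \<Longrightarrow> (x, y) \<in> R \<Longrightarrow> f (inv\<^bsub>G\<^esub> x) = f (inv\<^bsub>G\<^esub> y)"
    and mult: "\<And>f g x y. f \<in> invariant_functions (carrier G) R \<Longrightarrow> g \<in> invariant_functions (carrier G) R
      \<Longrightarrow> (x, y) \<in> R \<Longrightarrow> (f \<otimes>\<^bsub>group_ring G\<^esub> g) x = (f \<otimes>\<^bsub>group_ring G\<^esub> g) y"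
  shows "S_ring G (invariant_functions (carrier G) R)"
proof -
  interpret group G by fact
  interpret GR: ring "group_ring G" by (rule ring_group_ring) fact+
  let ?A = "invariant_functions (carrier G) R" and ?E = "inseparable (carrier G) R"
  have uminus: "\<ominus>\<^bsub>group_ring G\<^esub> f = (\<lambda>x. - f x)" if "f \<in> ?A" for f
    by (rule GR.minus_equality)
       (use that in \<open>auto simp: group_ring_def invariant_functions_def\<close>)
  have sub: "subring ?A (group_ring G)"
  proof (rule GR.subringI)
    show "?A \<subseteq> carrier (group_ring G)"
      by (auto simp: group_ring_def invariant_functions_def)
    show "\<one>\<^bsub>group_ring G\<^esub> \<in> ?A"
      using one by (auto simp: group_ring_def intro!: invariant_functionsI)
    show "\<ominus>\<^bsub>group_ring G\<^esub> f \<in> ?A" if "f \<in> ?A" for f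
      using that by (simp add: uminus[OF that]) (auto simp: invariant_functions_def)
    show "f \<oplus>\<^bsub>group_ring G\<^esub> g \<in> ?A" if "f \<in> ?A" "g \<in> ?A" for f g
      by (rule invariant_functionsI)
        (use that in \<open>simp_all add: group_ring_def invariant_functions_outside
          invariant_functionsD[of f] invariant_functionsD[of g]\<close>)
    show "f \<otimes>\<^bsub>group_ring G\<^esub> g \<in> ?A" if "f \<in> ?A" "g \<in> ?A" for f g
      by (rule invariant_functionsI) (use mult[OF that] in \<open>auto simp: group_ring_def\<close>)
  qed
  have "?E `` {\<one>} = {\<one>}"
  proof -
    have "simple_quantity {\<one>} \<in> ?A"
      using one by (intro simple_quantity_invariant) auto
    then have "y = \<one>" if "(\<one>, y) \<in> ?E" for y
      using that by (auto simp: inseparable_def simple_quantity_def split: if_splits)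
    then show ?thesis
      by (auto simp: inseparable_def)
  qed
  then have one_class: "{\<one>} \<in> carrier G // ?E"
    by (metis one_closed quotientI)
  have inv_A: "(\<lambda>x. if x \<in> carrier G then f (inv x) else 0) \<in> ?A" if "f \<in> ?A" for f
    using inv[OF that] R by (auto intro!: invariant_functionsI)
  have inv_E: "(inv x, inv y) \<in> ?E" if "(x, y) \<in> ?E" for x y
    using that inv_A by (fastforce simp: inseparable_def)
  have inv_class: "m_inv G ` W \<in> carrier G // ?E" if W: "W \<in> carrier G // ?E" for W
  proof -
    obtain x where x: "x \<in> carrier G" "W = ?E `` {x}"
      using W by (auto elim: quotientE)
    have "m_inv G ` W = ?E `` {inv x}"
    proof (intro equalityI subsetI)
      fix y assume "y \<in> ?E `` {inv x}"
      then have y: "(inv x, y) \<in> ?E" "y \<in> carrier G"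
        by (auto simp: inseparable_def)
      then have "(x, inv y) \<in> ?E"
        using inv_E[OF y(1)] x by simp
      then show "y \<in> m_inv G ` W"
        using x(2) y(2) by (auto intro: image_eqI[of _ _ "inv y"])
    qed (use x inv_E in auto)
    then show ?thesis
      using x(1) by (simp add: quotientI)
  qed
  show ?thesis
    unfolding S_ring_def
    using sub one_class inv_class partition_on_quotient[OF equiv_inseparable]
      invariant_functions_eq_simple_span[OF assms(2) R] by blast
qed

section \<open>Transitivity modules\<close>

lemma orbits_point_stabilizer:
  assumes "group G" "subgroup K (BijGroup (carrier G))"
  shows "partition_on (carrier G)
      (orbits (BijGroup (carrier G)\<lparr>carrier := point_stabilizer G K\<rparr>) (carrier G) (\<lambda>f. f))"
    and "\<And>x. x \<in> carrier G \<Longrightarrow> x \<in> orbit (BijGroup (carrier G)\<lparr>carrier := point_stabilizer G K\<rparr>) (\<lambda>f. f) x"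
proof -
  interpret group G by fact
  have act: "group_action (BijGroup (carrier G)\<lparr>carrier := H\<rparr>) (carrier G) (\<lambda>f. f)"
    if "subgroup H (BijGroup (carrier G))" for H
    using that group_BijGroup
    by (auto simp: group_action_def group_hom_def group_hom_axioms_def hom_def
        intro: group.subgroup_imp_group dest: subgroup.mem_carrier)
  interpret K: group_action "BijGroup (carrier G)\<lparr>carrier := K\<rparr>" "carrier G" "\<lambda>f. f"
    by (rule act) fact
  have "subgroup (point_stabilizer G K) (BijGroup (carrier G)\<lparr>carrier := K\<rparr>)"
    unfolding point_stabilizer_def by (rule K.stabilizer_subgroup) simp
  then have "subgroup (point_stabilizer G K) (BijGroup (carrier G))"
    using group.incl_subgroup[OF group_BijGroup assms(2)] by simp
  then interpret S: group_action "BijGroup (carrier G)\<lparr>carrier := point_stabilizer G K\<rparr>" "carrier G" "\<lambda>f. f"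
    by (rule act)
  show refl: "\<And>x. x \<in> carrier G \<Longrightarrow> x \<in> orbit (BijGroup (carrier G)\<lparr>carrier := point_stabilizer G K\<rparr>) (\<lambda>f. f) x"
    by (rule S.orbit_refl)
  show "partition_on (carrier G)
      (orbits (BijGroup (carrier G)\<lparr>carrier := point_stabilizer G K\<rparr>) (carrier G) (\<lambda>f. f))"
  proof (rule partition_onI)
    show "{} \<notin> orbits (BijGroup (carrier G)\<lparr>carrier := point_stabilizer G K\<rparr>) (carrier G) (\<lambda>f. f)"
      using refl by (fastforce simp: orbits_def)
  qed (use S.orbits_coverture S.disjoint_union in \<open>auto simp: disjnt_def\<close>)
qed

lemma transitivity_module_orbit:
  assumes "group G" "finite (carrier G)" "subgroup K (BijGroup (carrier G))"
    and "x \<in> carrier G" "y \<in> carrier G"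
    and "\<And>f. f \<in> transitivity_module K G \<Longrightarrow> f x = f y"
  obtains k where "k \<in> K" "k \<one>\<^bsub>G\<^esub> = \<one>\<^bsub>G\<^esub>" "k x = y"
proof -
  let ?B = "BijGroup (carrier G)\<lparr>carrier := point_stabilizer G K\<rparr>"
  let ?O = "orbit ?B (\<lambda>f. f) x"
  note P = orbits_point_stabilizer[OF assms(1,3)]
  have O: "?O \<in> orbits ?B (carrier G) (\<lambda>f. f)"
    using assms(4) by (auto simp: orbits_def)
  have "simple_quantity ?O \<in> transitivity_module K G"
    unfolding transitivity_module_def simple_span_eq_constant_on[OF P(1) assms(2)]
    using O P(1) by (fastforce simp: simple_quantity_def partition_on_def disjoint_def)
  then have "y \<in> ?O"
    using assms(6)[of "simple_quantity ?O"] P(2)[OF assms(4)]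
    by (simp add: simple_quantity_def split: if_splits)
  then show ?thesis
    using that by (auto simp: orbit_def point_stabilizer_def stabilizer_def)
qed

lemma transitivity_module_invariant:
  fixes G (structure)
  assumes "group G" "finite (carrier G)" and K: "subgroup K (BijGroup (carrier G))"
    and rt: "right_translations G \<subseteq> K"
    and k: "k \<in> K" and ab: "a \<in> carrier G" "b \<in> carrier G" and f: "f \<in> transitivity_module K G"
  shows "f (k b \<otimes>\<^bsub>G\<^esub> inv\<^bsub>G\<^esub> (k a)) = f (b \<otimes>\<^bsub>G\<^esub> inv\<^bsub>G\<^esub> a)"
proof -
  interpret group G by fact
  interpret K: subgroup K "BijGroup (carrier G)" by fact
  let ?B = "BijGroup (carrier G)\<lparr>carrier := point_stabilizer G K\<rparr>"
  let ?t = "\<lambda>g. \<lambda>x\<in>carrier G. x \<otimes>\<^bsub>G\<^esub> g"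
  have Bij: "h \<in> Bij (carrier G)" if "h \<in> K" for h
    using K.mem_carrier[OF that] by (simp add: BijGroup_def)
  have k_closed: "k x \<in> carrier G" if "x \<in> carrier G" for x
    using Bij[OF k] that by (auto simp: Bij_def bij_betw_def)
  have comp: "compose (carrier G) g h \<in> K" if "g \<in> K" "h \<in> K" for g h
    using K.m_closed[OF that] Bij[OF that(1)] Bij[OF that(2)] by (simp add: BijGroup_def)
  have t: "?t g \<in> K" if "g \<in> carrier G" for g
    using rt that by (auto simp: right_translations_def)
  define h where "h = compose (carrier G) (?t (inv (k a))) (compose (carrier G) k (?t a))"
  have hK: "h \<in> K"
    unfolding h_def using ab k_closed by (intro comp t k) auto
  have h_apply: "h x = k (x \<otimes> a) \<otimes> inv (k a)" if "x \<in> carrier G" for x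
    using that ab k_closed by (simp add: h_def compose_def)
  have "h \<in> point_stabilizer G K"
    using hK h_apply[of \<one>] ab k_closed by (simp add: point_stabilizer_def stabilizer_def)
  moreover have "h (b \<otimes> inv a) = k b \<otimes> inv (k a)"
    using h_apply[of "b \<otimes> inv a"] ab by (simp add: m_assoc)
  ultimately have "k b \<otimes> inv (k a) \<in> orbit ?B (\<lambda>f. f) (b \<otimes> inv a)"
    by (auto simp: orbit_def intro: exI[of _ h])
  moreover have "b \<otimes> inv a \<in> orbit ?B (\<lambda>f. f) (b \<otimes> inv a)"
    using orbits_point_stabilizer(2)[OF assms(1) K] ab by simp
  moreover have "orbit ?B (\<lambda>f. f) (b \<otimes> inv a) \<in> orbits ?B (carrier G) (\<lambda>f. f)"
    using ab by (auto simp: orbits_def)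
  ultimately show ?thesis
    using f unfolding transitivity_module_def
      simple_span_eq_constant_on[OF orbits_point_stabilizer(1)[OF assms(1) K] assms(2)] by blast
qed

section \<open>A wedge construction\<close>

lemma (in group) sum_convolution_iso:
  assumes "\<phi> \<in> iso G G" "S \<subseteq> carrier G" "\<phi> ` S = S" "x \<in> carrier G"
    and "\<And>y. y \<in> S \<Longrightarrow> f (\<phi> y) = f y"
    and "\<And>y. y \<in> S \<Longrightarrow> g (\<phi> (inv y \<otimes> x)) = g (inv y \<otimes> x)"
  shows "(\<Sum>y\<in>S. f y * g (inv y \<otimes> \<phi> x)) = (\<Sum>y\<in>S. f y * (g (inv y \<otimes> x) :: int))"
proof -
  have hom: "\<phi> \<in> hom G G" and inj: "inj_on \<phi> S"
    using assms(1,2) by (auto simp: iso_def bij_betw_def intro: inj_on_subset)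
  interpret \<phi>: group_hom G G \<phi>
    by unfold_locales (rule hom)
  have "(\<Sum>y\<in>S. f y * g (inv y \<otimes> \<phi> x)) = (\<Sum>y\<in>S. f (\<phi> y) * g (inv (\<phi> y) \<otimes> \<phi> x))"
    using sum.reindex[OF inj, of "\<lambda>y. f y * g (inv y \<otimes> \<phi> x)"] assms(3) by simp
  also have "\<dots> = (\<Sum>y\<in>S. f y * g (inv y \<otimes> x))"
  proof (rule sum.cong[OF refl])
    fix y assume y: "y \<in> S"
    then have "inv (\<phi> y) \<otimes> \<phi> x = \<phi> (inv y \<otimes> x)"
      using assms(2,4) by auto
    then show "f (\<phi> y) * g (inv (\<phi> y) \<otimes> \<phi> x) = f y * g (inv y \<otimes> x)"
      using assms(5,6) y by simp
  qed
  finally show ?thesis .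
qed

definition wedge_relation ::
    "('a, 'b) monoid_scheme \<Rightarrow> 'a set \<Rightarrow> 'a set \<Rightarrow> ('a \<Rightarrow> 'a) set \<Rightarrow> ('a \<Rightarrow> 'a) \<Rightarrow> ('a \<times> 'a) set"
  where "wedge_relation G U P H \<beta> =
    {(x, \<alpha> x) | x \<alpha>. x \<in> carrier G \<and> \<alpha> \<in> H} \<union>
    {(u, \<beta> u) | u. u \<in> U} \<union>
    {(x, x \<otimes>\<^bsub>G\<^esub> z) | x z. x \<in> carrier G - U \<and> z \<in> P}"

lemma wedge_relationE:
  assumes "(x, y) \<in> wedge_relation G U P H \<beta>"
  obtains \<alpha> where "\<alpha> \<in> H" "x \<in> carrier G" "y = \<alpha> x"
  | "x \<in> U" "y = \<beta> x"
  | z where "x \<in> carrier G" "x \<notin> U" "z \<in> P" "y = x \<otimes>\<^bsub>G\<^esub> z"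
  using assms by (auto simp: wedge_relation_def)

lemma wedge_relation_invariant:
  assumes "f \<in> invariant_functions X (wedge_relation G U P H \<beta>)"
  shows "\<alpha> \<in> H \<Longrightarrow> x \<in> carrier G \<Longrightarrow> f (\<alpha> x) = f x"
    and "u \<in> U \<Longrightarrow> f (\<beta> u) = f u"
    and "x \<in> carrier G \<Longrightarrow> x \<notin> U \<Longrightarrow> z \<in> P \<Longrightarrow> f (x \<otimes>\<^bsub>G\<^esub> z) = f x"
  by (rule invariant_functionsD[OF assms, symmetric]; auto simp: wedge_relation_def)+

text \<open>
  The condition \<open>fuse\<close> says that on \<open>U\<close> a function invariant under \<open>P\<close> and \<open>H\<close> is already invariant
  under \<open>\<beta>\<close>; this is what keeps products of two functions supported outside \<open>U\<close> inside the span.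
\<close>

lemma (in group) S_ring_wedge:
  assumes fin: "finite (carrier G)"
    and U: "subgroup U G" and P: "subgroup P G" "P \<subseteq> U"
    and central: "\<And>x z. x \<in> carrier G \<Longrightarrow> z \<in> P \<Longrightarrow> x \<otimes> z = z \<otimes> x"
    and H: "\<And>\<alpha>. \<alpha> \<in> H \<Longrightarrow> \<alpha> \<in> iso G G" "\<And>\<alpha>. \<alpha> \<in> H \<Longrightarrow> \<alpha> ` U = U"
    and \<beta>: "\<beta> \<in> iso G G" "\<beta> ` U = U"
    and fuse: "\<And>u. u \<in> U \<Longrightarrow> \<exists>z\<in>P. \<exists>z'\<in>P. \<exists>\<alpha>\<in>H. \<beta> u = \<alpha> (u \<otimes> z) \<otimes> z'"
  shows "S_ring G (invariant_functions (carrier G) (wedge_relation G U P H \<beta>))"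
proof -
  interpret U: subgroup U G by fact
  interpret P: subgroup P G by fact
  let ?R = "wedge_relation G U P H \<beta>"
  let ?A = "invariant_functions (carrier G) ?R"
  have iso_closed: "\<phi> x \<in> carrier G" if "\<phi> \<in> iso G G" "x \<in> carrier G" for \<phi> x
    using that by (auto simp: iso_def hom_def)
  have iso_one: "\<phi> x = \<one> \<longleftrightarrow> x = \<one>" if "\<phi> \<in> iso G G" "x \<in> carrier G" for \<phi> x
    using that hom_one[of \<phi> G] is_group
    by (metis (no_types, lifting) bij_betw_imp_inj_on inj_onD iso_def mem_Collect_eq one_closed)
  have iso_inv: "\<phi> (inv x) = inv (\<phi> x)" if "\<phi> \<in> iso G G" "x \<in> carrier G" for \<phi> x
    using that group_hom.hom_inv[of G G \<phi> x] is_group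
    by (simp add: iso_def group_hom_def group_hom_axioms_def)
  have iso_diff: "\<phi> ` (carrier G - U) = carrier G - U" if "\<phi> \<in> iso G G" "\<phi> ` U = U" for \<phi>
    using that U.subset inj_on_image_set_diff[of \<phi> "carrier G" "carrier G" U]
    by (auto simp: iso_def bij_betw_def)
  have not_U: "inv y \<otimes> x \<notin> U" if "x \<in> carrier G" "y \<in> carrier G" "x \<in> U \<longleftrightarrow> y \<notin> U" for x y
  proof
    assume *: "inv y \<otimes> x \<in> U"
    have "y \<otimes> (inv y \<otimes> x) = x" "x \<otimes> inv (inv y \<otimes> x) = y"
      using that by (simp_all add: m_assoc[symmetric] inv_mult_group)
    then show False
      using * that(3) by (metis U.m_closed U.m_inv_closed)
  qed
  show ?thesis
  proof (rule S_ring_invariant_functions[OF is_group fin])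
    show "?R \<subseteq> carrier G \<times> carrier G"
      using H(1) \<beta>(1) iso_closed U.subset P.subset by (auto simp: wedge_relation_def)
    show "x = \<one> \<longleftrightarrow> y = \<one>" if "(x, y) \<in> ?R" for x y
      using that
    proof (cases rule: wedge_relationE)
      case (3 z)
      then have "y \<noteq> \<one>"
        using P(2) U.m_inv_closed[of z] inv_equality[of x z] inv_inv[of z] by auto
      then show ?thesis
        using 3 by auto
    qed (use H(1) \<beta>(1) iso_one U.subset in auto)
    show "f (inv x) = f (inv y)" if f: "f \<in> ?A" and "(x, y) \<in> ?R" for f x y
      using that(2)
    proof (cases rule: wedge_relationE)
      case (1 \<alpha>)
      then show ?thesis
        using wedge_relation_invariant(1)[OF f, of \<alpha> "inv x"] iso_inv[OF H(1)] by simp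
    next
      case 2
      then show ?thesis
        using wedge_relation_invariant(2)[OF f, of "inv x"] iso_inv[OF \<beta>(1)] U.subset by auto
    next
      case (3 z)
      then have "inv y = inv x \<otimes> inv z" "inv x \<notin> U"
        using central[of "inv x" "inv z"] inv_mult_group[of x z] P.subset U.m_inv_closed[of "inv x"] by auto
      then show ?thesis
        using wedge_relation_invariant(3)[OF f, of "inv x" "inv z"] 3 by simp
    qed
    show "(f \<otimes>\<^bsub>group_ring G\<^esub> g) x = (f \<otimes>\<^bsub>group_ring G\<^esub> g) y"
      if f: "f \<in> ?A" and g: "g \<in> ?A" and xy: "(x, y) \<in> ?R" for f g x y
    proof -
      define c where "c S x = (\<Sum>y\<in>S. f y * g (inv y \<otimes> x))" for S x
      note f_inv = wedge_relation_invariant[OF f] and g_inv = wedge_relation_invariant[OF g]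
      have conv: "(f \<otimes>\<^bsub>group_ring G\<^esub> g) x = c U x + c (carrier G - U) x" if "x \<in> carrier G" for x
        using that sum.subset_diff[OF U.subset fin, of "\<lambda>y. f y * g (inv y \<otimes> x)"]
        by (simp add: group_ring_def c_def)
      have c_H: "c S (\<alpha> x) = c S x" if "\<alpha> \<in> H" "S = U \<or> S = carrier G - U" "x \<in> carrier G" for \<alpha> S x
        unfolding c_def
        by (rule sum_convolution_iso)
          (use that H[OF that(1)] iso_diff[OF H[OF that(1)]] U.subset in \<open>auto intro!: f_inv g_inv\<close>)
      have c_P: "c (carrier G - U) (u \<otimes> z) = c (carrier G - U) u" if "u \<in> U" "z \<in> P" for u z
        unfolding c_def
      proof (rule sum.cong[OF refl])
        fix y assume y: "y \<in> carrier G - U"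
        then have "inv y \<otimes> (u \<otimes> z) = inv y \<otimes> u \<otimes> z" "inv y \<otimes> u \<notin> U"
          using that not_U[of u y] U.subset P.subset by (auto simp: m_assoc)
        then show "f y * g (inv y \<otimes> (u \<otimes> z)) = f y * g (inv y \<otimes> u)"
          using that y g_inv(3)[of "inv y \<otimes> u" z] U.subset by auto
      qed
      show ?thesis
        using xy
      proof (cases rule: wedge_relationE)
        case (1 \<alpha>)
        then show ?thesis
          using c_H iso_closed[OF H(1)] by (simp add: conv)
      next
        case 2
        have "c U (\<beta> x) = c U x"
          unfolding c_def
          by (rule sum_convolution_iso) (use 2 \<beta> U.subset in \<open>auto intro!: f_inv g_inv\<close>)
        moreover have "c (carrier G - U) (\<beta> x) = c (carrier G - U) x"
        proof -
          obtain z z' \<alpha> where z: "z \<in> P" "z' \<in> P" "\<alpha> \<in> H" "\<beta> x = \<alpha> (x \<otimes> z) \<otimes> z'"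
            using fuse[OF 2(1)] by blast
          have xz: "x \<otimes> z \<in> U" "\<alpha> (x \<otimes> z) \<in> U"
            using 2 z P(2) H(2)[OF z(3)] by blast+
          show ?thesis
            using z xz 2 c_P c_H U.subset by (metis subsetD)
        qed
        ultimately show ?thesis
          using 2 iso_closed[OF \<beta>(1)] by (simp add: conv)
      next
        case (3 z)
        have z: "z \<in> carrier G" "z \<in> U"
          using 3 P(2) P.subset by auto
        have "c U (x \<otimes> z) = c U x"
          unfolding c_def
        proof (rule sum.cong[OF refl])
          fix y assume y: "y \<in> U"
          then have "inv y \<otimes> (x \<otimes> z) = inv y \<otimes> x \<otimes> z" "inv y \<otimes> x \<notin> U"
            using 3 z not_U[of x y] by (auto simp: m_assoc)
          then show "f y * g (inv y \<otimes> (x \<otimes> z)) = f y * g (inv y \<otimes> x)"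
            using 3 y g_inv(3)[of "inv y \<otimes> x" z] by auto
        qed
        moreover have "c (carrier G - U) (x \<otimes> z) = c (carrier G - U) x"
          unfolding c_def
        proof (rule sum.reindex_bij_witness[of _ "\<lambda>y. y \<otimes> z" "\<lambda>y. y \<otimes> inv z"])
          fix y assume y: "y \<in> carrier G - U"
          then show "y \<otimes> inv z \<otimes> z = y" "y \<otimes> z \<otimes> inv z = y"
            using z by (simp_all add: m_assoc)
          show yz: "y \<otimes> inv z \<in> carrier G - U"
            using y z U.m_closed[of "y \<otimes> inv z" z] by (auto simp: m_assoc)
          show "y \<otimes> z \<in> carrier G - U"
            using y z U.m_closed[of "y \<otimes> z" "inv z"] by (auto simp: m_assoc)
          have "inv (y \<otimes> inv z) \<otimes> x = z \<otimes> (inv y \<otimes> x)"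
            using y z 3 by (simp add: inv_mult_group m_assoc)
          also have "\<dots> = inv y \<otimes> (x \<otimes> z)"
            using y z 3 central[of "inv y \<otimes> x" z] by (simp add: m_assoc)
          finally show "f (y \<otimes> inv z) * g (inv (y \<otimes> inv z) \<otimes> x) = f y * g (inv y \<otimes> (x \<otimes> z))"
            using f_inv(3)[of y "inv z"] y 3 by simp
        qed
        ultimately show ?thesis
          using 3 z by (simp add: conv)
      qed
    qed
  qed
qed

section \<open>The S-ring over the quaternion group times a cyclic group\<close>

text \<open>Conjugation by \<open>i\<close>, conjugation by \<open>j\<close>, and the automorphism \<open>\<sigma>\<close>.\<close>

definition quat_i :: "int \<times> int \<times> int \<times> int \<Rightarrow> int \<times> int \<times> int \<times> int"
  where "quat_i = (\<lambda>(a, b, c, d). (a, b, - c, - d))"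

definition quat_j :: "int \<times> int \<times> int \<times> int \<Rightarrow> int \<times> int \<times> int \<times> int"
  where "quat_j = (\<lambda>(a, b, c, d). (a, - b, c, - d))"

definition quat_swap :: "int \<times> int \<times> int \<times> int \<Rightarrow> int \<times> int \<times> int \<times> int"
  where "quat_swap = (\<lambda>(a, b, c, d). (a, - b, d, c))"

lemma involution_iso:
  assumes "\<phi> \<in> hom G G" "\<And>x. x \<in> carrier G \<Longrightarrow> \<phi> (\<phi> x) = x"
  shows "\<phi> \<in> iso G G"
  using assms by (auto simp: iso_def hom_def intro!: bij_betw_byWitness[of _ \<phi>])

lemma quat_iso:
  "quat_i \<in> iso Q8 Q8" "quat_j \<in> iso Q8 Q8" "quat_swap \<in> iso Q8 Q8"
  by (rule involution_iso; auto simp: hom_def Q8_def quat_i_def quat_j_def quat_swap_def)+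

lemma inv_Q8: "(a, b, c, d) \<in> carrier Q8 \<Longrightarrow> inv\<^bsub>Q8\<^esub> (a, b, c, d) = (a, - b, - c, - d)"
  by (rule group.inv_equality[OF group_Q8]) (auto simp: Q8_def)

lemma mult_Q8:
  "(a, b, c, d) \<otimes>\<^bsub>Q8\<^esub> (a', b', c', d') =
    (a * a' - b * b' - c * c' - d * d', a * b' + b * a' + c * d' - d * c',
     a * c' - b * d' + c * a' + d * b', a * d' + b * c' - c * b' + d * a')"
  by (simp add: Q8_def)

lemma map_prod_iso:
  assumes "\<phi> \<in> iso G G" "\<psi> \<in> iso H H"
  shows "map_prod \<phi> \<psi> \<in> iso (G \<times>\<times> H) (G \<times>\<times> H)"
  using assms by (auto simp: iso_def hom_def intro!: bij_betw_map_prod)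

lemma integer_mod_group_uminus_iso:
  "(\<lambda>m. (- m) mod int n) \<in> iso (integer_mod_group n) (integer_mod_group n)"
proof (cases "n = 0")
  case False
  then show ?thesis
    by (intro involution_iso)
      (auto simp: hom_def carrier_integer_mod_group mod_simps)
qed (auto intro!: involution_iso simp: hom_def carrier_integer_mod_group)

text \<open>For \<open>n = p q\<close>, the subgroup \<open>P\<close> of order \<open>p\<close> consists of the multiples of \<open>q\<close>; it is \<open>M_q\<close> below.\<close>

context
  fixes q n :: nat
  assumes q: "q dvd n" "q > 2" and n: "2 * q < n"
begin

abbreviation "Z_n \<equiv> integer_mod_group n"
abbreviation "M_q \<equiv> {m \<in> carrier Z_n. int q dvd m}"
abbreviation "\<alpha>_i \<equiv> map_prod quat_i id :: _ \<times> int \<Rightarrow> _"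
abbreviation "\<alpha>_swap \<equiv> map_prod quat_swap (\<lambda>m. (- m) mod int n)"
abbreviation "\<beta>_j \<equiv> map_prod quat_j id :: _ \<times> int \<Rightarrow> _"

definition "wedge_R =
  wedge_relation (Q8 \<times>\<times> Z_n) (carrier Q8 \<times> M_q) ({\<one>\<^bsub>Q8\<^esub>} \<times> M_q) {id, \<alpha>_i, \<alpha>_swap} \<beta>_j"

definition "wedge_A = invariant_functions (carrier (Q8 \<times>\<times> Z_n)) wedge_R"

lemma carrier_Z_n: "carrier Z_n = {0..<int n}"
  using q n by (simp add: carrier_integer_mod_group)

lemma subgroup_M_q: "subgroup M_q Z_n"
proof (rule group.subgroupI[OF group_integer_mod_group])
  show "inv\<^bsub>Z_n\<^esub> m \<in> M_q" if "m \<in> M_q" for m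
    using that q n by (auto simp: carrier_Z_n dvd_mod)
  show "m \<otimes>\<^bsub>Z_n\<^esub> m' \<in> M_q" if "m \<in> M_q" "m' \<in> M_q" for m m'
    using that q n by (auto simp: carrier_Z_n dvd_mod)
  show "M_q \<noteq> {}"
    using n by (auto simp: carrier_Z_n intro!: exI[of _ 0])
qed auto

lemma group_G: "group (Q8 \<times>\<times> Z_n)"
  by (simp add: DirProd_group group_Q8)

lemma finite_G: "finite (carrier (Q8 \<times>\<times> Z_n))"
  by (simp add: carrier_Z_n Q8_def)

lemma uminus_image_M_q: "(\<lambda>m. (- m) mod int n) ` M_q = M_q"
proof (intro equalityI subsetI)
  fix m assume "m \<in> M_q"
  then show "m \<in> (\<lambda>m. (- m) mod int n) ` M_q"
    using q n by (intro image_eqI[of _ _ "(- m) mod int n"])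
      (auto simp: carrier_Z_n dvd_mod mod_simps)
qed (use q n in \<open>auto simp: carrier_Z_n dvd_mod\<close>)

lemma map_prod_image_U:
  assumes "\<phi> \<in> iso Q8 Q8" "\<psi> ` M_q = M_q"
  shows "map_prod \<phi> \<psi> ` (carrier Q8 \<times> M_q) = carrier Q8 \<times> M_q"
  using assms by (simp add: map_prod_surj_on iso_def bij_betw_def)

lemma S_ring_wedge_A: "S_ring (Q8 \<times>\<times> Z_n) wedge_A"
  unfolding wedge_A_def wedge_R_def
proof (rule group.S_ring_wedge[OF group_G finite_G])
  have one: "subgroup {\<one>\<^bsub>Q8\<^esub>} Q8"
    by (rule group.triv_subgroup[OF group_Q8])
  show "subgroup (carrier Q8 \<times> M_q) (Q8 \<times>\<times> Z_n)"
    by (intro DirProd_subgroups group.subgroup_self group_Q8 group_integer_mod_group subgroup_M_q)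
  show "subgroup ({\<one>\<^bsub>Q8\<^esub>} \<times> M_q) (Q8 \<times>\<times> Z_n)"
    by (intro DirProd_subgroups one group_Q8 group_integer_mod_group subgroup_M_q)
  show "{\<one>\<^bsub>Q8\<^esub>} \<times> M_q \<subseteq> carrier Q8 \<times> M_q"
    using monoid.one_closed[OF group.is_monoid[OF group_Q8]] by auto
  show "x \<otimes>\<^bsub>Q8 \<times>\<times> Z_n\<^esub> z = z \<otimes>\<^bsub>Q8 \<times>\<times> Z_n\<^esub> x"
    if "x \<in> carrier (Q8 \<times>\<times> Z_n)" "z \<in> {\<one>\<^bsub>Q8\<^esub>} \<times> M_q" for x z
    using that group.is_monoid[OF group_Q8]
    by (auto simp: monoid.l_one monoid.r_one add.commute)
  have id: "id \<in> iso Z_n Z_n" "id \<in> iso (Q8 \<times>\<times> Z_n) (Q8 \<times>\<times> Z_n)"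
    by (auto simp: iso_def hom_def)
  have id_image: "id ` M_q = M_q"
    by simp
  show "\<beta>_j \<in> iso (Q8 \<times>\<times> Z_n) (Q8 \<times>\<times> Z_n)" "\<beta>_j ` (carrier Q8 \<times> M_q) = carrier Q8 \<times> M_q"
    by (rule map_prod_iso map_prod_image_U quat_iso id(1) id_image)+
  have "\<alpha>_i \<in> iso (Q8 \<times>\<times> Z_n) (Q8 \<times>\<times> Z_n)" "\<alpha>_swap \<in> iso (Q8 \<times>\<times> Z_n) (Q8 \<times>\<times> Z_n)"
    by (rule map_prod_iso quat_iso id(1) integer_mod_group_uminus_iso)+
  then have "\<forall>\<alpha>\<in>{id, \<alpha>_i, \<alpha>_swap}. \<alpha> \<in> iso (Q8 \<times>\<times> Z_n) (Q8 \<times>\<times> Z_n)"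
    by (simp only: id(2) ball_simps simp_thms)
  then show "\<alpha> \<in> iso (Q8 \<times>\<times> Z_n) (Q8 \<times>\<times> Z_n)" if "\<alpha> \<in> {id, \<alpha>_i, \<alpha>_swap}" for \<alpha>
    using that by (rule bspec)
  have "\<alpha>_i ` (carrier Q8 \<times> M_q) = carrier Q8 \<times> M_q" "\<alpha>_swap ` (carrier Q8 \<times> M_q) = carrier Q8 \<times> M_q"
    by (rule map_prod_image_U quat_iso id_image uminus_image_M_q)+
  then have "\<forall>\<alpha>\<in>{id, \<alpha>_i, \<alpha>_swap}. \<alpha> ` (carrier Q8 \<times> M_q) = carrier Q8 \<times> M_q"
    by (simp only: image_id id_apply ball_simps simp_thms)
  then show "\<alpha> ` (carrier Q8 \<times> M_q) = carrier Q8 \<times> M_q" if "\<alpha> \<in> {id, \<alpha>_i, \<alpha>_swap}" for \<alpha>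
    using that by (rule bspec)
  show "\<exists>z\<in>{\<one>\<^bsub>Q8\<^esub>} \<times> M_q. \<exists>z'\<in>{\<one>\<^bsub>Q8\<^esub>} \<times> M_q. \<exists>\<alpha>\<in>{id, \<alpha>_i, \<alpha>_swap}.
      \<beta>_j u = \<alpha> (u \<otimes>\<^bsub>Q8 \<times>\<times> Z_n\<^esub> z) \<otimes>\<^bsub>Q8 \<times>\<times> Z_n\<^esub> z'"
    if "u \<in> carrier Q8 \<times> M_q" for u
  proof -
    obtain h m where u: "u = (h, m)" "h \<in> carrier Q8" "m \<in> M_q"
      using \<open>u \<in> _\<close> by blast
    have "quat_j h = h \<or> quat_j h = quat_i h \<or> quat_j h = quat_swap h"
      using u(2) by (auto simp: Q8_def quat_i_def quat_j_def quat_swap_def)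
    then have "\<exists>\<alpha>\<in>{id, \<alpha>_i, \<alpha>_swap}. \<alpha> (h, 0) = (quat_j h, 0)"
      by auto
    then obtain \<alpha> where \<alpha>: "\<alpha> \<in> {id, \<alpha>_i, \<alpha>_swap}" "\<alpha> (h, 0) = (quat_j h, 0)"
      by blast
    have closed: "quat_j h \<in> carrier Q8"
      using quat_iso(2) u(2) by (auto simp: iso_def hom_def)
    have "\<beta>_j u = \<alpha> (u \<otimes>\<^bsub>Q8 \<times>\<times> Z_n\<^esub> (\<one>\<^bsub>Q8\<^esub>, (- m) mod int n)) \<otimes>\<^bsub>Q8 \<times>\<times> Z_n\<^esub> (\<one>\<^bsub>Q8\<^esub>, m)"
    proof -
      have "u \<otimes>\<^bsub>Q8 \<times>\<times> Z_n\<^esub> (\<one>\<^bsub>Q8\<^esub>, (- m) mod int n) = (h, 0)"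
        using u(1,2) monoid.r_one[OF group.is_monoid[OF group_Q8]] by (simp add: mod_simps)
      moreover have "(quat_j h, 0) \<otimes>\<^bsub>Q8 \<times>\<times> Z_n\<^esub> (\<one>\<^bsub>Q8\<^esub>, m) = (quat_j h, m)"
        using u(3) closed monoid.r_one[OF group.is_monoid[OF group_Q8]] by (simp add: carrier_Z_n)
      ultimately show ?thesis
        using u(1) \<alpha>(2) by simp
    qed
    moreover have "(- m) mod int n \<in> M_q"
      using u(3) uminus_image_M_q by blast
    ultimately show ?thesis
      using \<alpha>(1) u(3) by blast
  qed
qed

lemma wedge_A_inner:
  assumes "W \<subseteq> carrier Q8 \<times> M_q"
    and "\<And>h m. m \<in> M_q \<Longrightarrow> (quat_i h, m) \<in> W \<longleftrightarrow> (h, m) \<in> W"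
    and "\<And>h m. m \<in> M_q \<Longrightarrow> (quat_swap h, (- m) mod int n) \<in> W \<longleftrightarrow> (h, m) \<in> W"
    and "\<And>h m. m \<in> M_q \<Longrightarrow> (quat_j h, m) \<in> W \<longleftrightarrow> (h, m) \<in> W"
  shows "simple_quantity W \<in> wedge_A"
  unfolding wedge_A_def
proof (rule simple_quantity_invariant)
  show "W \<subseteq> carrier (Q8 \<times>\<times> Z_n)"
    using assms(1) by auto
  have M_qD: "m \<in> M_q" if "(h, m) \<in> W" for h m
    using assms(1) that by blast
  show "x \<in> W \<longleftrightarrow> y \<in> W" if "(x, y) \<in> wedge_R" for x y
    using that unfolding wedge_R_def
  proof (cases rule: wedge_relationE)
    case (1 \<alpha>)
    obtain h m where x: "x = (h, m)"
      by (rule prod.exhaust)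
    then have m: "m \<in> carrier Z_n"
      using 1(2) by simp
    then have "(- m) mod int n \<in> M_q \<longleftrightarrow> m \<in> M_q"
      using q n by (simp add: carrier_Z_n dvd_mod_iff)
    moreover have "y = x \<or> y = (quat_i h, m) \<or> y = (quat_swap h, (- m) mod int n)"
      using 1(1,3) x by auto
    ultimately show ?thesis
      using assms(2)[of m h] assms(3)[of m h] M_qD[of _ m] M_qD[of _ "(- m) mod int n"] x by blast
  next
    case 2
    then obtain h m where "x = (h, m)" "y = (quat_j h, m)" "m \<in> M_q"
      by auto
    then show ?thesis
      using assms(4) by blast
  next
    case (3 z)
    obtain h m where x: "x = (h, m)"
      by (rule prod.exhaust)
    obtain z' where z: "z = (\<one>\<^bsub>Q8\<^esub>, z')" "int q dvd z'"
      using 3(3) by blast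
    have m: "\<not> int q dvd m"
      using 3(1,2) x by simp
    then have "\<not> int q dvd (m + z') mod int n"
      using z(2) q(1) by (simp add: dvd_mod_iff dvd_add_left_iff)
    moreover have "y = (h \<otimes>\<^bsub>Q8\<^esub> \<one>\<^bsub>Q8\<^esub>, (m + z') mod int n)"
      using 3(4) x z(1) by simp
    ultimately show ?thesis
      using M_qD x m by blast
  qed
qed

lemma wedge_A_outer:
  assumes "V \<subseteq> carrier Q8 \<times> {0<..<int q}"
    and "\<And>h r. (quat_i h, r) \<in> V \<longleftrightarrow> (h, r) \<in> V"
    and "\<And>h r. (quat_swap h, int q - r) \<in> V \<longleftrightarrow> (h, r) \<in> V"
  shows "simple_quantity {(h, m). m \<in> carrier Z_n \<and> (h, m mod int q) \<in> V} \<in> wedge_A"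
    (is "simple_quantity ?W \<in> _")
  unfolding wedge_A_def
proof (rule simple_quantity_invariant)
  show "?W \<subseteq> carrier (Q8 \<times>\<times> Z_n)"
    using assms(1) by auto
  have mod_n: "m mod int n \<in> carrier Z_n" "m mod int n mod int q = m mod int q" for m
    using q(1) n by (simp_all add: carrier_Z_n mod_mod_cancel)
  have not_M_q: "(h, m) \<notin> ?W" if "int q dvd m" for h m
    using assms(1) that by auto
  show "x \<in> ?W \<longleftrightarrow> y \<in> ?W" if "(x, y) \<in> wedge_R" for x y
    using that unfolding wedge_R_def
  proof (cases rule: wedge_relationE)
    case (1 \<alpha>)
    obtain h m where x: "x = (h, m)" "m \<in> carrier Z_n"
      using 1(2) by auto
    have "(quat_swap h, (- m) mod int q) \<in> V \<longleftrightarrow> (h, m mod int q) \<in> V"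
    proof (cases "m mod int q = 0")
      case True
      then show ?thesis
        using assms(1) by (auto simp: zmod_zminus1_eq_if)
    next
      case False
      then show ?thesis
        using assms(3)[of h "m mod int q"] by (simp add: zmod_zminus1_eq_if)
    qed
    moreover have "y = x \<or> y = (quat_i h, m) \<or> y = (quat_swap h, (- m) mod int n)"
      using 1(1,3) x by auto
    ultimately show ?thesis
      using x assms(2)[of h "m mod int q"] mod_n[of "- m"] by (elim disjE) simp_all
  next
    case 2
    then obtain h m where "x = (h, m)" "y = (quat_j h, m)" "int q dvd m"
      by auto
    then show ?thesis
      using not_M_q by blast
  next
    case (3 z)
    obtain h m z' where x: "x = (h, m)" "z = (\<one>\<^bsub>Q8\<^esub>, z')" "z' \<in> M_q"
      using 3(3) by (cases x) auto
    have "(m + z') mod int q = m mod int q"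
      using x(3) by (auto simp: dvd_def)
    moreover have "h \<otimes>\<^bsub>Q8\<^esub> \<one>\<^bsub>Q8\<^esub> = h" "m \<in> carrier Z_n"
      using 3(1) x(1) monoid.r_one[OF group.is_monoid[OF group_Q8]] by auto
    ultimately show ?thesis
      using 3 x mod_n[of "m + z'"] by auto
  qed
qed

lemma diff_G:
  assumes "(h, m) \<in> carrier (Q8 \<times>\<times> Z_n)" "(h', m') \<in> carrier (Q8 \<times>\<times> Z_n)"
  shows "(h', m') \<otimes>\<^bsub>Q8 \<times>\<times> Z_n\<^esub> inv\<^bsub>Q8 \<times>\<times> Z_n\<^esub> (h, m) = (h' \<otimes>\<^bsub>Q8\<^esub> inv\<^bsub>Q8\<^esub> h, (m' - m) mod int n)"
  using assms by (simp add: group_Q8 mod_simps)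

lemma not_schurian_wedge_A: "\<not> schurian (Q8 \<times>\<times> Z_n) wedge_A"
proof
  let ?G = "Q8 \<times>\<times> Z_n"
  let ?e = "(1, 0, 0, 0) :: int \<times> int \<times> int \<times> int"
  let ?i = "(0, 1, 0, 0) :: int \<times> int \<times> int \<times> int" and ?i' = "(0, -1, 0, 0) :: int \<times> int \<times> int \<times> int"
  let ?j = "(0, 0, 1, 0) :: int \<times> int \<times> int \<times> int" and ?j' = "(0, 0, -1, 0) :: int \<times> int \<times> int \<times> int"
  let ?k = "(0, 0, 0, 1) :: int \<times> int \<times> int \<times> int" and ?k' = "(0, 0, 0, -1) :: int \<times> int \<times> int \<times> int"
  let ?q = "int q" and ?q' = "int n - int q"
  interpret G: group ?G
    by (rule group_G)
  assume "schurian ?G wedge_A"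
  then obtain K where K: "subgroup K (BijGroup (carrier ?G))" "right_translations ?G \<subseteq> K"
    "wedge_A = transitivity_module K ?G"
    by (auto simp: schurian_def)
  have Q: "int n > 0" "?q > 0" "?q < int n" "?q dvd int n" "?q \<noteq> ?q'" "?q dvd ?q'" "1 < ?q" "2 * ?q < int n" "1 < int n"
    using q n by auto
  have carrier: "carrier Q8 = {?e, (-1, 0, 0, 0), ?i, ?i', ?j, ?j', ?k, ?k'}" "carrier Z_n = {0..<int n}"
    by (simp_all add: carrier_Z_n) (simp add: Q8_def)
  have q'_M_q: "?q' \<in> M_q" "?q \<in> M_q" "0 \<in> M_q"
    using Q by (simp_all add: carrier_Z_n)
  have uminus_M_q: "(- m) mod int n = ?q \<longleftrightarrow> m = ?q'" "(- m) mod int n = ?q' \<longleftrightarrow> m = ?q"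
    "(- m) mod int n = 0 \<longleftrightarrow> m = 0" if "m \<in> M_q" for m
    using that Q by (auto simp: carrier_Z_n zmod_zminus1_eq_if)
  have neg_eq_1: "- b = 1 \<longleftrightarrow> b = - 1" for b :: int
    by auto
  let ?Di = "{?i, ?i'} \<times> {0}" and ?Dj = "{?j, ?j', ?k, ?k'} \<times> {0}"
  let ?De = "{?e} \<times> {?q, ?q'}"
  let ?Djk = "{?j, ?j'} \<times> {?q'} \<union> {?k, ?k'} \<times> {?q}"
  have M_q_subset: "?Di \<subseteq> carrier Q8 \<times> M_q" "?Dj \<subseteq> carrier Q8 \<times> M_q"
    "?De \<subseteq> carrier Q8 \<times> M_q" "?Djk \<subseteq> carrier Q8 \<times> M_q"
    using q'_M_q by (simp_all add: Q8_def)
  have quat_simps: "quat_i (a, b, c, d) = (a, b, - c, - d)" "quat_j (a, b, c, d) = (a, - b, c, - d)"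
    "quat_swap (a, b, c, d) = (a, - b, d, c)" for a b c d
    by (simp_all add: quat_i_def quat_j_def quat_swap_def)
  note class_simps = split_paired_all Un_iff mem_Times_iff fst_conv snd_conv insert_iff empty_iff
    simp_thms quat_simps prod.inject uminus_M_q
  have Di: "simple_quantity ?Di \<in> wedge_A" and Dj: "simple_quantity ?Dj \<in> wedge_A"
    and De: "simple_quantity ?De \<in> wedge_A" and Djk: "simple_quantity ?Djk \<in> wedge_A"
    by (rule wedge_A_inner, rule M_q_subset; simp only: class_simps; simp add: neg_eq_1; blast)+
  let ?out = "\<lambda>V. {(h, m). m \<in> carrier Z_n \<and> (h, m mod int q) \<in> V}"
  let ?Ve = "{?e} \<times> {1, ?q - 1}"
  let ?Vi = "{(?i, ?q - 1), (?i', 1)}"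
  let ?Vj = "{?j, ?j'} \<times> {?q - 1} \<union> {?k, ?k'} \<times> {1}"
  have Ve: "simple_quantity (?out ?Ve) \<in> wedge_A" and Vi: "simple_quantity (?out ?Vi) \<in> wedge_A"
    and Vj: "simple_quantity (?out ?Vj) \<in> wedge_A"
    by (rule wedge_A_outer; use q in \<open>auto simp: Q8_def quat_simps neg_eq_1 split_paired_all\<close>)+

  have "f (?i, ?q) = f (?i', ?q)" if "f \<in> wedge_A" for f
    using wedge_relation_invariant(2)[OF that[unfolded wedge_A_def wedge_R_def], of "(?i, ?q)"] Q
    by (simp add: carrier_Z_n Q8_def quat_j_def)
  then obtain k where k: "k \<in> K" "k \<one>\<^bsub>?G\<^esub> = \<one>\<^bsub>?G\<^esub>" "k (?i, ?q) = (?i', ?q)"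
    using Q K(3)
    by (elim transitivity_module_orbit[OF group_G finite_G K(1), of "(?i, ?q)" "(?i', ?q)", rotated 3])
      (simp_all add: carrier)
  have k_closed: "k x \<in> carrier ?G" if "x \<in> carrier ?G" for x
    using subgroup.mem_carrier[OF K(1) k(1)] that by (auto simp: BijGroup_def Bij_def bij_betw_def)
  have pres: "k b \<otimes>\<^bsub>?G\<^esub> inv\<^bsub>?G\<^esub> (k a) \<in> W \<longleftrightarrow> b \<otimes>\<^bsub>?G\<^esub> inv\<^bsub>?G\<^esub> a \<in> W"
    if "simple_quantity W \<in> wedge_A" "a \<in> carrier ?G" "b \<in> carrier ?G" for W a b
    using transitivity_module_invariant[OF group_G finite_G K(1,2) k(1) that(2,3), of "simple_quantity W"] that(1) K(3)
    by (simp add: simple_quantity_def split: if_splits)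
  have pres_one: "k b \<in> W" if "simple_quantity W \<in> wedge_A" "b \<in> carrier ?G" "b \<in> W" for W b
    using pres[OF that(1) G.one_closed that(2)] that(2,3) k(2) k_closed[OF that(2)]
    by (metis G.inv_one G.r_one)
  have pres_diff: "(h2' \<otimes>\<^bsub>Q8\<^esub> inv\<^bsub>Q8\<^esub> h1', (m2' - m1') mod int n) \<in> W"
    if "simple_quantity W \<in> wedge_A" "k (h1, m1) = (h1', m1')" "k (h2, m2) = (h2', m2')"
      "(h1, m1) \<in> carrier ?G" "(h2, m2) \<in> carrier ?G"
      "(h2 \<otimes>\<^bsub>Q8\<^esub> inv\<^bsub>Q8\<^esub> h1, (m2 - m1) mod int n) \<in> W" for W h1 m1 h2 m2 h1' m1' h2' m2'
    using pres[OF that(1,4,5)] that k_closed[OF that(4)] k_closed[OF that(5)]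
    by (simp only: diff_G)
  have neg_q: "(- ?q) mod int n = ?q'"
    using Q by (simp add: zmod_zminus1_eq_if)
  have mod_n_q: "m mod int n mod ?q = m mod ?q" for m
    using Q by (simp add: mod_mod_cancel)
  have neg_1: "(- 1) mod ?q = ?q - 1"
    using Q by (simp add: zmod_zminus1_eq_if)

  have not_dvd: "\<not> int n dvd 2 * ?q - int n"
    using dvd_add[OF _ dvd_refl, of "int n" "2 * ?q - int n"] zdvd_imp_le[of "int n" "2 * ?q"] Q by auto
  have "k (?e, ?q) = (?e, ?q)"
  proof -
    obtain m where m: "k (?e, ?q) = (?e, m)" "m \<in> {?q, ?q'}"
      using pres_one[OF De, of "(?e, ?q)"] Q by (auto simp: carrier)
    have "(?i' \<otimes>\<^bsub>Q8\<^esub> inv\<^bsub>Q8\<^esub> ?e, (?q - m) mod int n) \<in> ?Di"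
      by (rule pres_diff[OF Di m(1) k(3)]) (use Q in \<open>auto simp: carrier inv_Q8 mult_Q8\<close>)
    then show ?thesis
      using m not_dvd by auto
  qed
  obtain hj where hj: "k (?j, 0) = (hj, 0)" "hj \<in> {?j, ?j', ?k, ?k'}"
    using pres_one[OF Dj, of "(?j, 0)"] Q by (auto simp: carrier)
  have "(hj \<otimes>\<^bsub>Q8\<^esub> inv\<^bsub>Q8\<^esub> ?e, (0 - ?q) mod int n) \<in> ?Djk"
    by (rule pres_diff[OF Djk \<open>k (?e, ?q) = (?e, ?q)\<close> hj(1)])
      (use Q neg_q in \<open>auto simp: carrier inv_Q8 mult_Q8\<close>)
  then have hj': "hj \<in> {?j, ?j'}"
    using hj(2) Q neg_q by (auto simp: carrier inv_Q8 mult_Q8)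
  obtain c where c: "k (?e, 1) = (?e, c)" "c mod ?q \<in> {1, ?q - 1}" "c \<in> carrier Z_n"
    using pres_one[OF Ve, of "(?e, 1)"] Q by (auto simp: carrier)
  have "(hj \<otimes>\<^bsub>Q8\<^esub> inv\<^bsub>Q8\<^esub> ?e, (0 - c) mod int n) \<in> ?out ?Vj"
    by (rule pres_diff[OF Vj c(1) hj(1)])
      (use Q in \<open>auto simp: carrier inv_Q8 mult_Q8 mod_n_q neg_1\<close>)
  then have c': "(- c) mod ?q = ?q - 1"
    using hj' Q by (auto simp: carrier inv_Q8 mult_Q8 mod_n_q)
  obtain hi where hi: "k (?i, 0) = (hi, 0)" "hi \<in> {?i, ?i'}"
    using pres_one[OF Di, of "(?i, 0)"] Q by (auto simp: carrier)
  have "(hi \<otimes>\<^bsub>Q8\<^esub> inv\<^bsub>Q8\<^esub> ?e, (0 - c) mod int n) \<in> ?out ?Vi"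
    by (rule pres_diff[OF Vi c(1) hi(1)])
      (use Q in \<open>auto simp: carrier inv_Q8 mult_Q8 mod_n_q neg_1\<close>)
  then have "hi = ?i"
    using hi(2) c' q Q by (auto simp: carrier inv_Q8 mult_Q8 mod_n_q)
  then have "(?i' \<otimes>\<^bsub>Q8\<^esub> inv\<^bsub>Q8\<^esub> ?i, (?q - 0) mod int n) \<in> ?De"
    using hi(1) by (intro pres_diff[OF De _ k(3)]) (use Q in \<open>auto simp: carrier inv_Q8 mult_Q8\<close>)
  then show False
    by (simp add: carrier inv_Q8 mult_Q8)
qed

end

theorem lemma5p2:
  fixes p q :: nat
  assumes "prime p" and "odd p" and "prime q" and "odd q"
  shows "\<not> Schur_group (Q8 \<times>\<times> integer_mod_group (p * q))"
proof -
  have "p > 2" "q > 2"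
    using assms by (metis dvd_refl le_neq_implies_less prime_ge_2_nat)+
  then have "q dvd p * q" "q > 2" "2 * q < p * q"
    by simp_all
  then show ?thesis
    using S_ring_wedge_A[of q "p * q"] not_schurian_wedge_A[of q "p * q"]
    unfolding Schur_group_def by blast
qed

end
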